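(* Let $n\ge 4$ be an integer, let $l,r$ be nonzero complex numbers, and assume that $(r^2)^k\neq 1$ for every $k\in\{1,\dots,n\}$. There exists a one-dimensional invariant subspace of the Lawrence-Krammer space $\mathcal V^{(n)}$ if and only if $l=\frac{1}{r^{2n-3}}$. If so, it is unique.
   Context: Let $l,r$ be nonzero complex numbers with $r^2\ne1$, $m=\frac1r-r$ and $F=\mathbb{Q}(l,r)\subset\mathbb{C}$. The BMW algebra $B(A_{n-1})$ is the unital associative $F$-algebra generated by invertible elements $g_1,\dots,g_{n-1}$, with $e_i:=\frac{l}{m}(g_i^2+m g_i-1)$, subject to: $g_ig_j=g_jg_i$ for $|i-j|\ge2$; $g_ig_{i+1}g_i=g_{i+1}g_ig_{i+1}$; $g_ie_i=l^{-1}e_i$; $e_ig_{i+1}e_i=l e_i$; $e_ig_{i-1}e_i=l e_i$ (whenever the indices make sense). The Lawrence-Krammer space $\mathcal V^{(n)}$ is the $F$-vector space with basis $\{w_{ij}:1\le i<j\le n\}$. It is a $B(A_{n-1})$-module, $g_k$ acting by the endomorphism $\nu_k$ defined, for $1\le k\le n-1$, by: - $\nu_k(w_{ij})=r\,w_{ij}$ if $\{i,j\}\cap\{k,k+1\}=\emptyset$; - $\nu_k(w_{k,k+1})=l^{-1}w_{k,k+1}$; - $\nu_k(w_{k,j})=w_{k+1,j}$ for $j\ge k+2$; - $\nu_k(w_{k+1,j})=w_{k,j}+m\,r^{j-k-2}\,w_{k,k+1}-m\,w_{k+1,j}$ for $j\ge k+2$; - $\nu_k(w_{i,k})=w_{i,k+1}$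 for $i\le k-1$; - $\nu_k(w_{i,k+1})=w_{i,k}+\frac{m}{l\,r^{k-1-i}}\,w_{k,k+1}-m\,w_{i,k+1}$ for $i\le k-1$. Invariant subspaces are $F$-subspaces stable under $B(A_{n-1})$; dimensions are over $F$. *)

theory Defs
  imports
    Complex_Main
    "HOL-Library.Poly_Mapping"
    "HOL-Algebra.Generated_Fields"
    "HOL-Algebra.QuotRing"
    "Jordan_Normal_Form.VS_Connect"
begin

(* F = Q(l,r), the subfield of the complex numbers generated by l and r. *)
definition base_field :: "complex \<Rightarrow> complex \<Rightarrow> complex ring" where
  "base_field l r = class_ring\<lparr>carrier := generate_field class_ring {l, r}\<rparr>"

definition mpar :: "complex \<Rightarrow> complex" where
  "mpar r = 1 / r - r"

definition scale :: "complex \<Rightarrow> ('a \<Rightarrow>\<^sub>0 complex) \<Rightarrow> ('a \<Rightarrow>\<^sub>0 complex)" where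
  "scale c = Poly_Mapping.map (\<lambda>x. c * x)"


subsection \<open>The BMW algebra\<close>

datatype bmw_letter = Gen nat | GenInv nat

datatype bmw_word = Word (letters: "bmw_letter list")

instantiation bmw_word :: monoid_add
begin

definition zero_bmw_word :: bmw_word where "0 = Word []"

definition plus_bmw_word :: "bmw_word \<Rightarrow> bmw_word \<Rightarrow> bmw_word" where
  "u + v = Word (letters u @ letters v)"

instance
  by standard (simp_all add: zero_bmw_word_def plus_bmw_word_def)

end

definition bmw_words :: "nat \<Rightarrow> bmw_word set" where
  "bmw_words n = {w. set (letters w) \<subseteq> Gen ` {1..<n} \<union> GenInv ` {1..<n}}"

(* The free unital associative F-algebra on the letters Gen k, GenInv k (1 <= k <= n-1): finitely
   supported functions from words to F. The product of poly_mapping is the convolution along +,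
   here the concatenation of words. The letters GenInv k become the inverses of the Gen k in the
   quotient. *)
definition free_alg :: "nat \<Rightarrow> complex \<Rightarrow> complex \<Rightarrow> (bmw_word \<Rightarrow>\<^sub>0 complex) ring" where
  "free_alg n l r = class_ring\<lparr>carrier :=
     {a. Poly_Mapping.keys a \<subseteq> bmw_words n \<and>
         (\<forall>w. Poly_Mapping.lookup a w \<in> carrier (base_field l r))}\<rparr>"

abbreviation bmw_g :: "nat \<Rightarrow> bmw_word \<Rightarrow>\<^sub>0 complex" where
  "bmw_g k \<equiv> Poly_Mapping.single (Word [Gen k]) 1"

abbreviation bmw_ginv :: "nat \<Rightarrow> bmw_word \<Rightarrow>\<^sub>0 complex" where
  "bmw_ginv k \<equiv> Poly_Mapping.single (Word [GenInv k]) 1"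

definition bmw_e :: "complex \<Rightarrow> complex \<Rightarrow> nat \<Rightarrow> bmw_word \<Rightarrow>\<^sub>0 complex" where
  "bmw_e l r k = scale (l / mpar r) (bmw_g k * bmw_g k + scale (mpar r) (bmw_g k) - 1)"

definition bmw_rels :: "nat \<Rightarrow> complex \<Rightarrow> complex \<Rightarrow> (bmw_word \<Rightarrow>\<^sub>0 complex) set" where
  "bmw_rels n l r =
     {bmw_g k * bmw_ginv k - 1 |k. k \<in> {1..<n}}
   \<union> {bmw_ginv k * bmw_g k - 1 |k. k \<in> {1..<n}}
   \<union> {bmw_g i * bmw_g j - bmw_g j * bmw_g i |i j. i \<in> {1..<n} \<and> j \<in> {1..<n} \<and> \<bar>int i - int j\<bar> \<ge> 2}
   \<union> {bmw_g i * bmw_g (i + 1) * bmw_g i - bmw_g (i + 1) * bmw_g i * bmw_g (i + 1) |i. i \<in> {1..<n} \<and> i + 1 \<in> {1..<n}}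
   \<union> {bmw_g i * bmw_e l r i - scale (inverse l) (bmw_e l r i) |i. i \<in> {1..<n}}
   \<union> {bmw_e l r i * bmw_g (i + 1) * bmw_e l r i - scale l (bmw_e l r i) |i. i \<in> {1..<n} \<and> i + 1 \<in> {1..<n}}
   \<union> {bmw_e l r i * bmw_g (i - 1) * bmw_e l r i - scale l (bmw_e l r i) |i. i \<in> {1..<n} \<and> i - 1 \<in> {1..<n}}"

(* B(A_{n-1}); its elements are the cosets of the two-sided ideal generated by the relations. *)
definition bmw_algebra :: "nat \<Rightarrow> complex \<Rightarrow> complex \<Rightarrow> (bmw_word \<Rightarrow>\<^sub>0 complex) set ring" where
  "bmw_algebra n l r = free_alg n l r Quot (Idl\<^bsub>free_alg n l r\<^esub> (bmw_rels n l r))"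


subsection \<open>The Lawrence-Krammer space\<close>

definition lk_index :: "nat \<Rightarrow> (nat \<times> nat) set" where
  "lk_index n = {(i, j). 1 \<le> i \<and> i < j \<and> j \<le> n}"

(* Formal F-linear combinations of the lk_w i j. The fields mult and one are required by the record
   type only; they are not used in modules. *)
definition lk_space :: "nat \<Rightarrow> complex \<Rightarrow> complex \<Rightarrow> (complex, nat \<times> nat \<Rightarrow>\<^sub>0 complex) module" where
  "lk_space n l r =
     \<lparr>carrier = {v. Poly_Mapping.keys v \<subseteq> lk_index n \<and>
                    (\<forall>p. Poly_Mapping.lookup v p \<in> carrier (base_field l r))},
      mult = (\<lambda>_ _. 0), one = 0, zero = 0, add = (+), smult = scale\<rparr>"

abbreviation lk_w :: "nat \<Rightarrow> nat \<Rightarrow> (nat \<times> nat \<Rightarrow>\<^sub>0 complex)" where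
  "lk_w i j \<equiv> Poly_Mapping.single (i, j) 1"

(* nu_k on basis vectors; for i < j the case distinction leaves j >= k+2 in the second and third
   case and i <= k-1 in the fourth and fifth, so no subtraction below is truncated. *)
definition nu_basis :: "complex \<Rightarrow> complex \<Rightarrow> nat \<Rightarrow> nat \<Rightarrow> nat \<Rightarrow> (nat \<times> nat \<Rightarrow>\<^sub>0 complex)" where
  "nu_basis l r k i j =
     (if i = k \<and> j = k + 1 then scale (inverse l) (lk_w k (k + 1))
      else if i = k then lk_w (k + 1) j
      else if i = k + 1 then
        lk_w k j + scale (mpar r * r ^ (j - k - 2)) (lk_w k (k + 1)) - scale (mpar r) (lk_w (k + 1) j)
      else if j = k then lk_w i (k + 1)
      else if j = k + 1 then
        lk_w i k + scale (mpar r / (l * r ^ (k - 1 - i))) (lk_w k (k + 1)) - scale (mpar r) (lk_w i (k + 1))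
      else scale r (lk_w i j))"

definition nu :: "complex \<Rightarrow> complex \<Rightarrow> nat \<Rightarrow> (nat \<times> nat \<Rightarrow>\<^sub>0 complex) \<Rightarrow> (nat \<times> nat \<Rightarrow>\<^sub>0 complex)" where
  "nu l r k v = (\<Sum>(i, j)\<in>Poly_Mapping.keys v. scale (Poly_Mapping.lookup v (i, j)) (nu_basis l r k i j))"

fun letter_act :: "nat \<Rightarrow> complex \<Rightarrow> complex \<Rightarrow> bmw_letter \<Rightarrow> (nat \<times> nat \<Rightarrow>\<^sub>0 complex) \<Rightarrow> (nat \<times> nat \<Rightarrow>\<^sub>0 complex)" where
  "letter_act n l r (Gen k) = nu l r k"
| "letter_act n l r (GenInv k) = inv_into (carrier (lk_space n l r)) (nu l r k)"

definition free_act :: "nat \<Rightarrow> complex \<Rightarrow> complex \<Rightarrow> (bmw_word \<Rightarrow>\<^sub>0 complex) \<Rightarrow> (nat \<times> nat \<Rightarrow>\<^sub>0 complex) \<Rightarrow> (nat \<times> nat \<Rightarrow>\<^sub>0 complex)" where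
  "free_act n l r a v =
     (\<Sum>u\<in>Poly_Mapping.keys a. scale (Poly_Mapping.lookup a u) (foldr (letter_act n l r) (letters u) v))"

(* F-subspaces stable under the BMW algebra. The class X of a in the BMW algebra acts as a does; the
   nu_k satisfy the defining relations, so all representatives of X act alike and quantifying over
   all of them expresses stability under X. *)
definition lk_invariant :: "nat \<Rightarrow> complex \<Rightarrow> complex \<Rightarrow> (nat \<times> nat \<Rightarrow>\<^sub>0 complex) set \<Rightarrow> bool" where
  "lk_invariant n l r W \<longleftrightarrow>
     VectorSpace.subspace (base_field l r) W (lk_space n l r) \<and>
     (\<forall>X\<in>carrier (bmw_algebra n l r). \<forall>a\<in>X. \<forall>v\<in>W. free_act n l r a v \<in> W)"

definition lk_dim :: "nat \<Rightarrow> complex \<Rightarrow> complex \<Rightarrow> (nat \<times> nat \<Rightarrow>\<^sub>0 complex) set \<Rightarrow> nat" where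
  "lk_dim n l r W = vectorspace.dim (base_field l r) (lk_space n l r\<lparr>carrier := W\<rparr>)"


subsection \<open>Well-formedness\<close>

lemma lookup_scale [simp]: "Poly_Mapping.lookup (scale c v) p = c * Poly_Mapping.lookup v p"
  by (simp add: scale_def map.rep_eq when_def)

lemma keys_scale: "Poly_Mapping.keys (scale c v) \<subseteq> Poly_Mapping.keys v"
  by (auto simp: in_keys_iff)

lemma field_base_field: "field (base_field l r)"
  unfolding base_field_def by (rule field.generate_field_is_field[OF class_field]) simp

lemma subring_generated: "subring (generate_field class_ring {l, r}) (class_ring :: complex ring)"
  by (rule subfieldE(1), rule field.generate_field_is_subfield[OF class_field]) simp

lemma base_field_closed [simp]:
  fixes l r :: complex
  shows "0 \<in> carrier (base_field l r)" "1 \<in> carrier (base_field l r)"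
    "l \<in> carrier (base_field l r)" "r \<in> carrier (base_field l r)"
    "x \<in> carrier (base_field l r) \<Longrightarrow> - x \<in> carrier (base_field l r)"
    "x \<in> carrier (base_field l r) \<Longrightarrow> y \<in> carrier (base_field l r) \<Longrightarrow> x + y \<in> carrier (base_field l r)"
    "x \<in> carrier (base_field l r) \<Longrightarrow> y \<in> carrier (base_field l r) \<Longrightarrow> x - y \<in> carrier (base_field l r)"
    "x \<in> carrier (base_field l r) \<Longrightarrow> y \<in> carrier (base_field l r) \<Longrightarrow> x * y \<in> carrier (base_field l r)"
    "x \<in> carrier (base_field l r) \<Longrightarrow> inverse x \<in> carrier (base_field l r)"
    "x \<in> carrier (base_field l r) \<Longrightarrow> y \<in> carrier (base_field l r) \<Longrightarrow> x / y \<in> carrier (base_field l r)"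
proof -
  let ?K = "generate_field (class_ring :: complex ring) {l, r}"
  have [simp]: "carrier (base_field l r) = ?K"
    by (simp add: base_field_def)
  have inv: "inverse x \<in> ?K" if "x \<in> ?K" for x
  proof (cases "x = 0")
    case True
    then show ?thesis using that by simp
  next
    case False
    have "inv\<^bsub>class_ring\<^esub> x = inverse x"
      using False by (intro monoid.inv_char[OF ring.is_monoid[OF class_ring.ring_axioms]]) auto
    then show ?thesis
      using generate_field.m_inv[OF that] False by simp
  qed
  have add: "x + y \<in> ?K" if "x \<in> ?K" "y \<in> ?K" for x y
    using generate_field.eng_add[OF that] by simp
  have mult: "x * y \<in> ?K" if "x \<in> ?K" "y \<in> ?K" for x y
    using generate_field.eng_mult[OF that] by simp
  have minus: "- x \<in> ?K" if "x \<in> ?K" for x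
    using generate_field.a_inv[OF that] by (simp add: class_ring_simps)
  show one: "1 \<in> carrier (base_field l r)"
    using generate_field.one[of "class_ring :: complex ring"] by simp
  then show "0 \<in> carrier (base_field l r)"
    using add[of 1 "- 1"] minus[of 1] by simp
  show "l \<in> carrier (base_field l r)" "r \<in> carrier (base_field l r)"
    by (auto intro: generate_field.incl)
  show "x \<in> carrier (base_field l r) \<Longrightarrow> - x \<in> carrier (base_field l r)"
    "x \<in> carrier (base_field l r) \<Longrightarrow> y \<in> carrier (base_field l r) \<Longrightarrow> x + y \<in> carrier (base_field l r)"
    "x \<in> carrier (base_field l r) \<Longrightarrow> y \<in> carrier (base_field l r) \<Longrightarrow> x * y \<in> carrier (base_field l r)"
    "x \<in> carrier (base_field l r) \<Longrightarrow> inverse x \<in> carrier (base_field l r)"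
    using minus add mult inv by auto
  show "x \<in> carrier (base_field l r) \<Longrightarrow> y \<in> carrier (base_field l r) \<Longrightarrow> x - y \<in> carrier (base_field l r)"
    using add[of x "- y"] minus[of y] by simp
  show "x \<in> carrier (base_field l r) \<Longrightarrow> y \<in> carrier (base_field l r) \<Longrightarrow> x / y \<in> carrier (base_field l r)"
    using mult[of x "inverse y"] inv[of y] by (simp add: divide_inverse)
qed

lemma base_field_simps [simp]:
  "x \<oplus>\<^bsub>base_field l r\<^esub> y = x + y" "x \<otimes>\<^bsub>base_field l r\<^esub> y = x * y"
  "\<zero>\<^bsub>base_field l r\<^esub> = 0" "\<one>\<^bsub>base_field l r\<^esub> = 1"
  by (simp_all add: base_field_def)

lemma lk_space_closed:
  "0 \<in> carrier (lk_space n l r)"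
  "x \<in> carrier (lk_space n l r) \<Longrightarrow> y \<in> carrier (lk_space n l r) \<Longrightarrow> x + y \<in> carrier (lk_space n l r)"
  "c \<in> carrier (base_field l r) \<Longrightarrow> x \<in> carrier (lk_space n l r) \<Longrightarrow> scale c x \<in> carrier (lk_space n l r)"
  using keys_add[of x y] keys_scale[of c x] by (auto simp: lk_space_def lookup_add)

lemma lk_space_simps:
  "x \<oplus>\<^bsub>lk_space n l r\<^esub> y = x + y" "\<zero>\<^bsub>lk_space n l r\<^esub> = 0" "c \<odot>\<^bsub>lk_space n l r\<^esub> x = scale c x"
  by (simp_all add: lk_space_def)

lemma vectorspace_lk_space: "vectorspace (base_field l r) (lk_space n l r)"
proof (rule vectorspace.intro)
  show "field (base_field l r)" by (rule field_base_field)
  show "module (base_field l r) (lk_space n l r)"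
  proof (rule moduleI)
    show "cring (base_field l r)"
      using field_base_field by (simp add: field_def domain_def)
    show "abelian_group (lk_space n l r)"
    proof (rule abelian_groupI)
      fix x assume x: "x \<in> carrier (lk_space n l r)"
      show "\<exists>y\<in>carrier (lk_space n l r). y \<oplus>\<^bsub>lk_space n l r\<^esub> x = \<zero>\<^bsub>lk_space n l r\<^esub>"
        using x by (intro bexI[of _ "- x"]) (auto simp: lk_space_def)
    qed (auto simp: lk_space_closed lk_space_simps ac_simps)
  qed (auto simp: lk_space_closed lk_space_simps lookup_add algebra_simps intro!: poly_mapping_eqI)
qed

lemma bmw_words_plus: "u \<in> bmw_words n \<Longrightarrow> v \<in> bmw_words n \<Longrightarrow> u + v \<in> bmw_words n"
  by (auto simp: bmw_words_def plus_bmw_word_def)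

lemma poly_mapping_sum_single:
  "(a :: 'a \<Rightarrow>\<^sub>0 'b::comm_monoid_add) = (\<Sum>u\<in>Poly_Mapping.keys a. Poly_Mapping.single u (Poly_Mapping.lookup a u))"
  by (rule poly_mapping_eqI) (auto simp: lookup_sum lookup_single when_def in_keys_iff)

lemma free_alg_add:
  "a \<in> carrier (free_alg n l r) \<Longrightarrow> b \<in> carrier (free_alg n l r) \<Longrightarrow> a + b \<in> carrier (free_alg n l r)"
  using keys_add[of a b] by (auto simp: free_alg_def lookup_add)

lemma free_alg_zero: "0 \<in> carrier (free_alg n l r)"
  by (simp add: free_alg_def)

lemma free_alg_single:
  "u \<in> bmw_words n \<Longrightarrow> c \<in> carrier (base_field l r) \<Longrightarrow> Poly_Mapping.single u c \<in> carrier (free_alg n l r)"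
  by (auto simp: free_alg_def lookup_single when_def)

lemma free_alg_one: "1 \<in> carrier (free_alg n l r)"
proof -
  have "0 \<in> bmw_words n"
    by (simp add: bmw_words_def zero_bmw_word_def)
  then show ?thesis
    using free_alg_single[of 0 n 1 l r] by simp
qed

lemma free_alg_uminus: "a \<in> carrier (free_alg n l r) \<Longrightarrow> - a \<in> carrier (free_alg n l r)"
  by (simp add: free_alg_def)

lemma free_alg_diff:
  "a \<in> carrier (free_alg n l r) \<Longrightarrow> b \<in> carrier (free_alg n l r) \<Longrightarrow> a - b \<in> carrier (free_alg n l r)"
  using free_alg_add[of a n l r "- b"] free_alg_uminus[of b n l r] by simp

lemma free_alg_sum:
  "(\<And>x. x \<in> A \<Longrightarrow> f x \<in> carrier (free_alg n l r)) \<Longrightarrow> sum f A \<in> carrier (free_alg n l r)"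
  by (induction A rule: infinite_finite_induct) (auto simp: free_alg_zero free_alg_add)

lemma free_alg_scale:
  "c \<in> carrier (base_field l r) \<Longrightarrow> a \<in> carrier (free_alg n l r) \<Longrightarrow> scale c a \<in> carrier (free_alg n l r)"
  using keys_scale[of c a] by (auto simp: free_alg_def)

lemma free_alg_mult:
  assumes "a \<in> carrier (free_alg n l r)" "b \<in> carrier (free_alg n l r)"
  shows "a * b \<in> carrier (free_alg n l r)"
proof -
  have "a * b = (\<Sum>u\<in>Poly_Mapping.keys a. \<Sum>v\<in>Poly_Mapping.keys b.
      Poly_Mapping.single (u + v) (Poly_Mapping.lookup a u * Poly_Mapping.lookup b v))"
  proof -
    have "a * b = (\<Sum>u\<in>Poly_Mapping.keys a. Poly_Mapping.single u (Poly_Mapping.lookup a u)) *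
        (\<Sum>v\<in>Poly_Mapping.keys b. Poly_Mapping.single v (Poly_Mapping.lookup b v))"
      by (simp only: poly_mapping_sum_single[symmetric])
    then show ?thesis
      by (simp only: sum_product mult_single)
  qed
  also have "\<dots> \<in> carrier (free_alg n l r)"
    using assms by (intro free_alg_sum free_alg_single bmw_words_plus) (auto simp: free_alg_def)
  finally show ?thesis .
qed

lemma ring_free_alg: "ring (free_alg n l r)"
proof -
  have "subring (carrier (free_alg n l r)) (class_ring :: (bmw_word \<Rightarrow>\<^sub>0 complex) ring)"
    by (rule ring.subringI[OF class_ring.ring_axioms])
      (auto simp: class_ring_simps free_alg_one free_alg_uminus free_alg_mult free_alg_add)
  then have "ring (class_ring\<lparr>carrier := carrier (free_alg n l r)\<rparr> :: (bmw_word \<Rightarrow>\<^sub>0 complex) ring)"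
    by (rule ring.subring_is_ring[OF class_ring.ring_axioms])
  then show ?thesis by (simp add: free_alg_def)
qed

lemma bmw_rels_subset: "bmw_rels n l r \<subseteq> carrier (free_alg n l r)"
proof -
  have g: "bmw_g k \<in> carrier (free_alg n l r)" "bmw_ginv k \<in> carrier (free_alg n l r)" if "k \<in> {1..<n}" for k
    using that by (auto intro!: free_alg_single simp: bmw_words_def)
  have m: "mpar r \<in> carrier (base_field l r)"
    by (simp add: mpar_def)
  have "bmw_e l r k \<in> carrier (free_alg n l r)" if "k \<in> {1..<n}" for k
    unfolding bmw_e_def using g[OF that] m
    by (intro free_alg_scale free_alg_diff free_alg_add free_alg_mult free_alg_one) auto
  then show ?thesis
    using g unfolding bmw_rels_def
    by (auto intro!: free_alg_diff free_alg_mult free_alg_scale free_alg_one)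
qed

lemma ideal_bmw_rels: "ideal (Idl\<^bsub>free_alg n l r\<^esub> (bmw_rels n l r)) (free_alg n l r)"
  by (rule ring.genideal_ideal[OF ring_free_alg bmw_rels_subset])

lemma ring_bmw_algebra: "ring (bmw_algebra n l r)"
  unfolding bmw_algebra_def by (rule ideal.quotient_is_ring[OF ideal_bmw_rels])

end

(* A one-dimensional invariant subspace is spanned by a common eigenvector v = sum a_ij w_ij of the
   nu_k, with eigenvalues ev_k, nonzero since nu_k is injective. Comparing coefficients gives
   a_(k+1,j) = ev_k a_kj and a_(i,k+1) = ev_k a_ik, so all a_ij are nonzero; for n >= 4 every k has a
   w_ij with i, j distinct from k, k+1, on which nu_k is multiplication by r, so ev_k = r. Hence
   a_ij = c r^(i+j). The only remaining condition is the coefficient of w_(k,k+1): its two sums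
   telescope because m = 1/r - r, leaving r^3 / l = r^(2n) for every k. *)

theory Submission
  imports Defs
begin

section \<open>One-dimensional vector spaces\<close>

text \<open>Independent subsets of \<open>W\<close> stay independent in \<open>V\<close>, so their
  size is bounded by the dimension of \<open>V\<close> and a largest one is a basis of
  \<open>W\<close>. Without finite dimensionality, \<open>dim = 1\<close> would not supply a basis
  vector.\<close>

lemma (in vectorspace) fin_dim_subspace:
  assumes "fin_dim" and W: "subspace K W V"
  shows "vectorspace.fin_dim K (vs W)"
proof -
  interpret W: vectorspace K "vs W"
    using W by (rule subspace_is_vs)
  have sub: "submodule K W V"
    using W by simp
  let ?P = "\<lambda>S. S \<subseteq> carrier (vs W) \<and> W.lin_indpt S"
  have "finite S \<and> card S \<le> dim" if "?P S" for S
  proof -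
    have "S \<subseteq> W" "lin_indpt S"
      using that span_li_not_depend(2)[OF _ sub, of S] by auto
    moreover have "W \<subseteq> carrier V"
      using sub by (simp add: submodule_def)
    ultimately show ?thesis
      using li_le_dim[OF \<open>fin_dim\<close>] by blast
  qed
  moreover have "?P {}"
    by (simp add: W.lin_dep_def)
  ultimately obtain B where "finite B" "maximal B ?P"
    using maximal_exists[of ?P dim "{}"] by blast
  then show ?thesis
    using W.max_li_is_basis[of B] unfolding W.fin_dim_def W.basis_def by blast
qed

lemma (in vectorspace) span_singleton:
  assumes "v \<in> carrier V"
  shows "span {v} = {c \<odot>\<^bsub>V\<^esub> v |c. c \<in> carrier K}"
proof -
  have lincomb: "lincomb a {v} = a v \<odot>\<^bsub>V\<^esub> v" if "a \<in> {v} \<rightarrow> carrier K" for a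
    using that assms by (auto simp: lincomb_def)
  have span: "span {v} = {lincomb a {v} |a. a \<in> {v} \<rightarrow> carrier K}"
    using assms by (intro finite_span) auto
  show ?thesis
  proof (intro equalityI subsetI)
    fix x assume "x \<in> span {v}"
    then obtain a where "a \<in> {v} \<rightarrow> carrier K" "x = lincomb a {v}"
      unfolding span by blast
    then show "x \<in> {c \<odot>\<^bsub>V\<^esub> v |c. c \<in> carrier K}"
      using lincomb[of a] by (intro CollectI exI[of _ "a v"]) auto
  next
    fix x assume "x \<in> {c \<odot>\<^bsub>V\<^esub> v |c. c \<in> carrier K}"
    then obtain c where "c \<in> carrier K" "x = c \<odot>\<^bsub>V\<^esub> v" by blast
    then show "x \<in> span {v}"
      unfolding span using lincomb[of "\<lambda>_. c"] by (intro CollectI exI[of _ "\<lambda>_. c"]) auto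
  qed
qed

lemma (in vectorspace) lin_indpt_singleton:
  assumes "v \<in> carrier V" "v \<noteq> \<zero>\<^bsub>V\<^esub>"
  shows "lin_indpt {v}"
proof -
  \<comment> \<open>Adjoining \<open>v\<close> to the independent empty set creates a dependence
    only if \<open>v\<close> lies in the zero space.\<close>
  have "v \<in> span {} \<longleftrightarrow> lin_dep ({} \<union> {v})"
    using assms by (intro lin_dep_iff_in_span) (auto simp: lin_dep_def)
  moreover have "span {} = {\<zero>\<^bsub>V\<^esub>}"
    by (auto simp: span_def lincomb_def)
  ultimately show ?thesis
    using assms by simp
qed

lemma (in vectorspace) dim_eq_1E:
  assumes "fin_dim" "dim = 1"
  obtains v where "v \<in> carrier V" "v \<noteq> \<zero>\<^bsub>V\<^esub>" "carrier V = {c \<odot>\<^bsub>V\<^esub> v |c. c \<in> carrier K}"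
proof -
  obtain B where B: "finite B" "basis B"
    using finite_basis_exists[OF assms(1)] by blast
  then have "card B = 1"
    using dim_basis[of B] assms by simp
  then obtain v where v: "B = {v}"
    by (auto simp: card_1_singleton_iff)
  have "v \<in> carrier V" "lin_indpt {v}" "span {v} = carrier V"
    using B v by (auto simp: basis_def)
  then show ?thesis
    using that[of v] span_singleton[of v] zero_nin_lin_indpt[of "{v}"] one_zeroI by fastforce
qed

lemma (in vectorspace) dim_eq_1I:
  assumes "v \<in> carrier V" "v \<noteq> \<zero>\<^bsub>V\<^esub>" "carrier V = {c \<odot>\<^bsub>V\<^esub> v |c. c \<in> carrier K}"
  shows "dim = 1"
proof -
  have "basis {v}"
    using assms span_singleton[of v] lin_indpt_singleton[of v] by (auto simp: basis_def)
  then show ?thesis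
    using dim_basis[of "{v}"] by simp
qed


section \<open>Lines in the Lawrence-Krammer space\<close>

definition line :: "complex \<Rightarrow> complex \<Rightarrow> ('a \<Rightarrow>\<^sub>0 complex) \<Rightarrow> ('a \<Rightarrow>\<^sub>0 complex) set" where
  "line l r v = {scale c v |c. c \<in> carrier (base_field l r)}"

lemma scale_0_left [simp]: "scale 0 v = 0"
  and scale_1_left [simp]: "scale 1 v = v"
  and scale_scale [simp]: "scale c (scale d v) = scale (c * d) v"
  and scale_add_left: "scale (c + d) v = scale c v + scale d v"
  by (rule poly_mapping_eqI; simp add: lookup_add algebra_simps)+

lemma finite_lk_index [simp]: "finite (lk_index n)"
  by (rule finite_subset[of _ "{1..n} \<times> {1..n}"]) (auto simp: lk_index_def)

text \<open>The cases match the six clauses of \<open>nu_basis\<close>, with the inequalities that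
  keep its exponents free of truncated subtraction.\<close>

lemma lk_index_cases [consumes 1, case_names middle left left' right right' disjoint]:
  assumes "(i, j) \<in> lk_index n"
  obtains "i = k" "j = k + 1" | "i = k" "k + 2 \<le> j" "j \<le> n" | "i = k + 1" "k + 2 \<le> j" "j \<le> n"
    | "j = k" "1 \<le> i" "i < k" | "j = k + 1" "1 \<le> i" "i < k" | "{i, j} \<inter> {k, k + 1} = {}"
proof -
  have ij: "1 \<le> i" "i < j" "j \<le> n"
    using assms by (auto simp: lk_index_def)
  consider "i = k" | "i = k + 1" | "j = k" | "j = k + 1" "i \<noteq> k" | "{i, j} \<inter> {k, k + 1} = {}"
    by blast
  then show ?thesis
  proof cases
    case 1
    then show ?thesis using ij that(1,2) by (cases "j = k + 1") auto
  next
    case 2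
    then show ?thesis using ij that(3) by auto
  next
    case 3
    then show ?thesis using ij that(4) by auto
  next
    case 4
    then show ?thesis using ij that(5) by auto
  qed (rule that(6))
qed

lemma lk_space_keys: "v \<in> carrier (lk_space n l r) \<Longrightarrow> Poly_Mapping.keys v \<subseteq> lk_index n"
  by (simp add: lk_space_def)

lemma lk_space_lookup: "v \<in> carrier (lk_space n l r) \<Longrightarrow> Poly_Mapping.lookup v p \<in> carrier (base_field l r)"
  by (cases p) (simp add: lk_space_def)

text \<open>The finitely many \<open>w_ij\<close> span; \<open>fin_dim_subspace\<close> then passes
  finiteness on to invariant subspaces.\<close>

lemma fin_dim_lk_space: "vectorspace.fin_dim (base_field l r) (lk_space n l r)"
proof -
  interpret V: vectorspace "base_field l r" "lk_space n l r"
    by (rule vectorspace_lk_space)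
  let ?B = "(\<lambda>p. Poly_Mapping.single p 1) ` lk_index n"
  have B: "?B \<subseteq> carrier (lk_space n l r)"
    by (auto simp: lk_space_def lookup_single when_def)
  have span: "submodule (base_field l r) (V.span ?B) (lk_space n l r)"
    using B by (rule V.span_is_submodule)
  have "v \<in> V.span ?B" if v: "v \<in> carrier (lk_space n l r)" for v
  proof -
    \<comment> \<open>The support of \<open>v\<close> is replaced by an arbitrary index set, so that
      induction can run with \<open>v\<close> fixed.\<close>
    have "(\<Sum>p\<in>A. Poly_Mapping.single p (Poly_Mapping.lookup v p)) \<in> V.span ?B" if "A \<subseteq> lk_index n" for A
      using finite_subset[OF that finite_lk_index] that
    proof (induction A rule: finite_induct)
      case empty
      then show ?case
        using submodule.zero_closed[OF span] by (simp add: lk_space_simps)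
    next
      case (insert p A)
      have "Poly_Mapping.single p 1 \<in> V.span ?B"
        using V.in_own_span[OF B] insert.prems by auto
      then have "scale (Poly_Mapping.lookup v p) (Poly_Mapping.single p 1) \<in> V.span ?B"
        using submodule.smult_closed[OF span lk_space_lookup[OF v, of p]] by (simp add: lk_space_simps)
      moreover have "scale (Poly_Mapping.lookup v p) (Poly_Mapping.single p 1) = Poly_Mapping.single p (Poly_Mapping.lookup v p)"
        by (rule poly_mapping_eqI) (simp add: lookup_single when_def)
      ultimately show ?case
        using insert submodule.m_closed[OF span] by (simp add: lk_space_simps)
    qed
    from this[OF lk_space_keys[OF v]] show ?thesis
      by (simp flip: poly_mapping_sum_single)
  qed
  then have "V.span ?B = carrier (lk_space n l r)"
    using V.span_is_subset2[OF B] by blast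
  then show ?thesis
    using B unfolding V.fin_dim_def by (intro exI[of _ ?B]) auto
qed

lemma subspace_line:
  assumes v: "v \<in> carrier (lk_space n l r)"
  shows "VectorSpace.subspace (base_field l r) (line l r v) (lk_space n l r)"
proof (intro subspace.intro submodule.intro)
  show "vectorspace (base_field l r) (lk_space n l r)"
    by (rule vectorspace_lk_space)
  then show "module (base_field l r) (lk_space n l r)"
    by (simp add: vectorspace_def)
  show "line l r v \<subseteq> carrier (lk_space n l r)"
    using v by (auto simp: line_def lk_space_closed)
  show "\<zero>\<^bsub>lk_space n l r\<^esub> \<in> line l r v"
    unfolding line_def lk_space_simps by (intro CollectI exI[of _ 0]) simp
  show "x \<oplus>\<^bsub>lk_space n l r\<^esub> y \<in> line l r v" if "x \<in> line l r v" "y \<in> line l r v" for x y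
  proof -
    from that obtain c d where "c \<in> carrier (base_field l r)" "x = scale c v"
      "d \<in> carrier (base_field l r)" "y = scale d v"
      by (auto simp: line_def)
    then show ?thesis
      unfolding line_def lk_space_simps by (intro CollectI exI[of _ "c + d"]) (simp add: scale_add_left)
  qed
  show "c \<odot>\<^bsub>lk_space n l r\<^esub> x \<in> line l r v" if "c \<in> carrier (base_field l r)" "x \<in> line l r v" for c x
    using that unfolding line_def lk_space_simps by fastforce
qed

lemma lk_dim_eq_1_iff:
  "VectorSpace.subspace (base_field l r) W (lk_space n l r) \<and> lk_dim n l r W = 1 \<longleftrightarrow>
    (\<exists>v\<in>carrier (lk_space n l r). v \<noteq> 0 \<and> W = line l r v)" (is "?L \<longleftrightarrow> ?R")
proof
  interpret V: vectorspace "base_field l r" "lk_space n l r"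
    by (rule vectorspace_lk_space)
  assume L: ?L
  then interpret W: vectorspace "base_field l r" "V.vs W"
    by (blast intro: V.subspace_is_vs)
  have "W.fin_dim"
    using L V.fin_dim_subspace[OF fin_dim_lk_space] by blast
  moreover have "W.dim = 1"
    using L by (simp add: lk_dim_def)
  ultimately obtain v where "v \<in> W" "v \<noteq> 0" "W = line l r v"
    by (rule W.dim_eq_1E) (simp add: line_def lk_space_simps)
  moreover have "W \<subseteq> carrier (lk_space n l r)"
    using L V.is_module submodule.subset by blast
  ultimately show ?R
    by blast
next
  interpret V: vectorspace "base_field l r" "lk_space n l r"
    by (rule vectorspace_lk_space)
  assume ?R
  then obtain v where v: "v \<in> carrier (lk_space n l r)" "v \<noteq> 0" "W = line l r v"
    by blast
  then have W: "VectorSpace.subspace (base_field l r) W (lk_space n l r)"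
    using subspace_line by blast
  then interpret W: vectorspace "base_field l r" "V.vs W"
    by (rule V.subspace_is_vs)
  have "v \<in> line l r v"
    unfolding line_def by (intro CollectI exI[of _ 1]) simp
  then have "W.dim = 1"
    using v by (intro W.dim_eq_1I[of v]) (auto simp: line_def lk_space_simps)
  then show ?L
    using W by (simp add: lk_dim_def)
qed

text \<open>A nonzero \<open>c\<close> in F is invertible in F, so a spanning vector may be
  normalised; this is what makes the invariant line unique.\<close>

lemma line_scale:
  assumes "c \<in> carrier (base_field l r)" "c \<noteq> 0"
  shows "line l r (scale c v) = line l r v"
proof (intro equalityI subsetI)
  fix x assume "x \<in> line l r v"
  then obtain d where "d \<in> carrier (base_field l r)" "x = scale d v"
    by (auto simp: line_def)
  then show "x \<in> line l r (scale c v)"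
    using assms unfolding line_def by (intro CollectI exI[of _ "d / c"]) simp
qed (use assms in \<open>auto simp: line_def\<close>)


section \<open>Coefficients of the generator action\<close>

lemma lookup_nu_basis:
  "Poly_Mapping.lookup (nu_basis l r k i j) q =
    (if i = k \<and> j = k + 1 then if q = (k, k + 1) then inverse l else 0
     else if i = k then if q = (k + 1, j) then 1 else 0
     else if i = k + 1 then (if q = (k, j) then 1 else 0)
       + (if q = (k, k + 1) then mpar r * r ^ (j - k - 2) else 0) - (if q = (k + 1, j) then mpar r else 0)
     else if j = k then if q = (i, k + 1) then 1 else 0
     else if j = k + 1 then (if q = (i, k) then 1 else 0)
       + (if q = (k, k + 1) then mpar r / (l * r ^ (k - 1 - i)) else 0) - (if q = (i, k + 1) then mpar r else 0)
     else if q = (i, j) then r else 0)"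
  by (simp add: nu_basis_def lookup_add lookup_minus lookup_single when_def)

text \<open>Indices outside the support contribute zero. Summing over a larger set lets vectors with
  different supports be compared termwise.\<close>

lemma lookup_nu:
  assumes "finite A" "Poly_Mapping.keys v \<subseteq> A"
  shows "Poly_Mapping.lookup (nu l r k v) q =
    (\<Sum>(i, j)\<in>A. Poly_Mapping.lookup v (i, j) * Poly_Mapping.lookup (nu_basis l r k i j) q)"
proof -
  have "Poly_Mapping.lookup (nu l r k v) q =
    (\<Sum>(i, j)\<in>Poly_Mapping.keys v. Poly_Mapping.lookup v (i, j) * Poly_Mapping.lookup (nu_basis l r k i j) q)"
    by (simp add: nu_def lookup_sum case_prod_unfold)
  also have "\<dots> = (\<Sum>(i, j)\<in>A. Poly_Mapping.lookup v (i, j) * Poly_Mapping.lookup (nu_basis l r k i j) q)"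
    using assms by (intro sum.mono_neutral_left) (auto simp: in_keys_iff)
  finally show ?thesis .
qed

lemma nu_scale: "nu l r k (scale c v) = scale c (nu l r k v)"
  using keys_scale[of c v]
  by (intro poly_mapping_eqI) 
    (simp add: lookup_nu[of "Poly_Mapping.keys v"] sum_distrib_left case_prod_unfold mult.assoc)

lemma nu_diff: "nu l r k (u - v) = nu l r k u - nu l r k v"
proof (intro poly_mapping_eqI)
  fix q
  let ?A = "Poly_Mapping.keys u \<union> Poly_Mapping.keys v"
  have "Poly_Mapping.keys (u - v) \<subseteq> ?A"
    by (auto simp: in_keys_iff lookup_minus)
  then show "Poly_Mapping.lookup (nu l r k (u - v)) q = Poly_Mapping.lookup (nu l r k u - nu l r k v) q"
    by (simp add: lookup_nu[of ?A] lookup_minus case_prod_unfold left_diff_distrib sum_subtractf)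
qed

text \<open>Away from \<open>w_(k,k+1)\<close>, each coefficient of an image under
  \<open>nu_k\<close> comes from at most two basis vectors. The points \<open>x\<close> and
  \<open>y\<close> may coincide, so a single contribution is covered by
  \<open>d = 0\<close>.\<close>

lemma sum_two_deltas:
  fixes f :: "'a \<Rightarrow> 'b::comm_ring"
  assumes "finite A" "x \<in> A" "y \<in> A" and "\<And>p. p \<in> A \<Longrightarrow> g p = (if p = x then c else 0) + (if p = y then d else 0)"
  shows "(\<Sum>p\<in>A. f p * g p) = c * f x + d * f y"
proof -
  have "(\<Sum>p\<in>A. f p * g p) = (\<Sum>p\<in>A. (if p = x then c * f x else 0) + (if p = y then d * f y else 0))"
    by (rule sum.cong) (auto simp: assms(4) algebra_simps)
  then show ?thesis
    using assms(1-3) by (simp add: sum.distrib)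
qed

section \<open>Coefficients of the image of a fixed vector under one generator\<close>

context
  fixes n k :: nat and l r :: complex and v :: "nat \<times> nat \<Rightarrow>\<^sub>0 complex"
  assumes keys: "Poly_Mapping.keys v \<subseteq> lk_index n" and k: "1 \<le> k" "k < n"
begin

abbreviation (input) in_coeff where "in_coeff i j \<equiv> Poly_Mapping.lookup v (i, j)"
abbreviation (input) out_coeff where "out_coeff i j \<equiv> Poly_Mapping.lookup (nu l r k v) (i, j)"

lemma nu_coeff_sum: "out_coeff i j = (\<Sum>p\<in>lk_index n. Poly_Mapping.lookup v p *
    (case p of (i', j') \<Rightarrow> Poly_Mapping.lookup (nu_basis l r k i' j') (i, j)))"
  using lookup_nu[OF finite_lk_index keys, of l r k "(i, j)"] by (simp add: case_prod_unfold)

text \<open>Since \<open>k < n\<close>, each \<open>nu_k(w_ij)\<close> is supported on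
  \<open>lk_index n\<close>; eigenvector equations therefore need checking only there.\<close>

lemma nu_coeff_outside:
  assumes "(i, j) \<notin> lk_index n"
  shows "out_coeff i j = 0"
proof -
  have "Poly_Mapping.lookup (nu_basis l r k i' j') (i, j) = 0" if p: "(i', j') \<in> lk_index n" for i' j'
  proof -
    have ij: "1 \<le> i \<Longrightarrow> i < j \<Longrightarrow> n < j"
      using assms by (auto simp: lk_index_def)
    have ij': "1 \<le> i'" "i' < j'" "j' \<le> n"
      using p by (auto simp: lk_index_def)
    from p show ?thesis
      by (cases rule: lk_index_cases[where k = k]) (use ij ij' k in \<open>auto simp: lookup_nu_basis\<close>)
  qed
  then show ?thesis
    unfolding nu_coeff_sum by (intro sum.neutral) auto
qed

lemma nu_coeff_disjoint:
  assumes "(i, j) \<in> lk_index n" "{i, j} \<inter> {k, k + 1} = {}"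
  shows "out_coeff i j = r * in_coeff i j"
proof -
  have "Poly_Mapping.lookup (nu_basis l r k i' j') (i, j) = (if i' = i \<and> j' = j then r else 0)"
    if "(i', j') \<in> lk_index n" for i' j'
    using that by (cases rule: lk_index_cases[where k = k]) (use assms(2) in \<open>auto simp: lookup_nu_basis\<close>)
  then have "out_coeff i j = r * in_coeff i j + 0 * in_coeff i j"
    unfolding nu_coeff_sum using assms(1)
    by (intro sum_two_deltas[OF finite_lk_index]) (auto split: if_splits)
  then show ?thesis by simp
qed

text \<open>For \<open>j \<ge> k + 2\<close> the correction terms along \<open>w_(k,k+1)\<close> do
  not reach these positions, so \<open>nu_k\<close> acts on the pair of coefficients by a 2 by 2
  matrix.\<close>

lemma nu_coeff_left:
  assumes "k + 2 \<le> j" "j \<le> n"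
  shows "out_coeff k j = in_coeff (k + 1) j" and "out_coeff (k + 1) j = in_coeff k j - mpar r * in_coeff (k + 1) j"
proof -
  have "out_coeff k j = 1 * in_coeff (k + 1) j + 0 * in_coeff (k + 1) j"
    unfolding nu_coeff_sum
    using assms k by (intro sum_two_deltas[OF finite_lk_index]) (auto simp: lk_index_def lookup_nu_basis split: if_splits)
  moreover have "out_coeff (k + 1) j = 1 * in_coeff k j + - mpar r * in_coeff (k + 1) j"
    unfolding nu_coeff_sum
    using assms k by (intro sum_two_deltas[OF finite_lk_index]) (auto simp: lk_index_def lookup_nu_basis split: if_splits)
  ultimately show "out_coeff k j = in_coeff (k + 1) j" "out_coeff (k + 1) j = in_coeff k j - mpar r * in_coeff (k + 1) j"
    by simp_all
qed

lemma nu_coeff_right: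
  assumes "1 \<le> i" "i < k"
  shows "out_coeff i k = in_coeff i (k + 1)" and "out_coeff i (k + 1) = in_coeff i k - mpar r * in_coeff i (k + 1)"
proof -
  have "out_coeff i k = 1 * in_coeff i (k + 1) + 0 * in_coeff i (k + 1)"
    unfolding nu_coeff_sum
    using assms k by (intro sum_two_deltas[OF finite_lk_index]) (auto simp: lk_index_def lookup_nu_basis split: if_splits)
  moreover have "out_coeff i (k + 1) = 1 * in_coeff i k + - mpar r * in_coeff i (k + 1)"
    unfolding nu_coeff_sum
    using assms k by (intro sum_two_deltas[OF finite_lk_index]) (auto simp: lk_index_def lookup_nu_basis split: if_splits)
  ultimately show "out_coeff i k = in_coeff i (k + 1)" "out_coeff i (k + 1) = in_coeff i k - mpar r * in_coeff i (k + 1)"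
    by simp_all
qed

text \<open>Besides \<open>w_(k,k+1)\<close> itself, only the \<open>w_(k+1,j)\<close> and the
  \<open>w_(i,k+1)\<close> have images with a component along \<open>w_(k,k+1)\<close>.\<close>

lemma nu_coeff_middle:
  "out_coeff k (k + 1) = inverse l * in_coeff k (k + 1)
    + (\<Sum>j\<in>{k+2..n}. mpar r * r ^ (j - k - 2) * in_coeff (k + 1) j)
    + (\<Sum>i\<in>{1..<k}. mpar r / (l * r ^ (k - 1 - i)) * in_coeff i (k + 1))"
proof -
  let ?f = "\<lambda>p. Poly_Mapping.lookup v p *
    (case p of (i', j') \<Rightarrow> Poly_Mapping.lookup (nu_basis l r k i' j') (k, k + 1))"
  let ?A = "{(k, k + 1)}" and ?B = "Pair (k + 1) ` {k+2..n}" and ?C = "(\<lambda>i. (i, k + 1)) ` {1..<k}"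
  have "out_coeff k (k + 1) = sum ?f (?A \<union> ?B \<union> ?C)"
    unfolding nu_coeff_sum using k
    by (intro sum.mono_neutral_right[OF finite_lk_index])
      (auto simp: lk_index_def lookup_nu_basis image_iff split: if_splits)
  also have "\<dots> = sum ?f (?A \<union> ?B) + sum ?f ?C"
    by (rule sum.union_disjoint) auto
  also have "sum ?f (?A \<union> ?B) = sum ?f ?A + sum ?f ?B"
    by (rule sum.union_disjoint) auto
  also have "sum ?f ?A = inverse l * in_coeff k (k + 1)"
    by (simp add: lookup_nu_basis)
  also have "sum ?f ?B = (\<Sum>j\<in>{k+2..n}. mpar r * r ^ (j - k - 2) * in_coeff (k + 1) j)"
    by (subst sum.reindex) (auto simp: inj_on_def lookup_nu_basis intro!: sum.cong)
  also have "sum ?f ?C = (\<Sum>i\<in>{1..<k}. mpar r / (l * r ^ (k - 1 - i)) * in_coeff i (k + 1))"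
    by (subst sum.reindex) (auto simp: inj_on_def lookup_nu_basis intro!: sum.cong)
  finally show ?thesis .
qed

text \<open>The system is triangular: the first left and right equations kill the coefficients at
  \<open>k + 1\<close>, the second ones those at \<open>k\<close>. Both sums in the middle equation
  then vanish and leave \<open>inverse l\<close> times the last coefficient.\<close>

lemma nu_eq_0:
  assumes "nu l r k v = 0" "l \<noteq> 0" "r \<noteq> 0"
  shows "v = 0"
proof -
  have b: "out_coeff i j = 0" for i j
    using assms(1) by simp
  have left: "in_coeff k j = 0" "in_coeff (k + 1) j = 0" if "k + 2 \<le> j" "j \<le> n" for j
    using nu_coeff_left[OF that] by (simp_all add: b)
  have right: "in_coeff i k = 0" "in_coeff i (k + 1) = 0" if "1 \<le> i" "i < k" for i
    using nu_coeff_right[OF that] by (simp_all add: b)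
  have middle: "in_coeff k (k + 1) = 0"
    using nu_coeff_middle assms(2) left right by (simp add: b)
  have "in_coeff i j = 0" for i j
  proof (cases "(i, j) \<in> lk_index n")
    case False
    then show ?thesis using keys by (auto simp: in_keys_iff)
  next
    case True
    then show ?thesis
    proof (cases rule: lk_index_cases[where k = k])
      case disjoint
      then show ?thesis
        using nu_coeff_disjoint[OF True disjoint] assms(3) by (simp add: b)
    qed (use left right middle in auto)
  qed
  then show ?thesis
    by (intro poly_mapping_eqI) auto
qed

text \<open>The difference measures how far \<open>v\<close> is from satisfying the eigenvalue
  \<open>r\<close> equation at \<open>w_(k,k+1)\<close>. The boundary terms depending on
  \<open>k\<close> cancel, so all \<open>k\<close> impose the same condition.\<close>

lemma nu_coeff_middle_powers:
  assumes a: "\<And>i j. (i, j) \<in> lk_index n \<Longrightarrow> in_coeff i j = c * r ^ (i + j)" and "r \<noteq> 0"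
  shows "out_coeff k (k + 1) - r * in_coeff k (k + 1) = c * (r ^ 3 / l - r ^ (2 * n))"
proof -
  have 1: "(\<Sum>j\<in>{k+2..n}. mpar r * r ^ (j - k - 2) * in_coeff (k + 1) j) = c * (r ^ (2 * k + 2) - r ^ (2 * n))"
  proof -
    \<comment> \<open>The powers combine to \<open>r ^ (2 * j - 1)\<close>, and the factor
      \<open>1 / r - r\<close> turns this into a difference of consecutive even powers.\<close>
    have "mpar r * r ^ (j - k - 2) * in_coeff (k + 1) j = - (c * r ^ (2 * j)) + c * r ^ (2 * (j - 1))"
      if j: "j \<in> {k+2..n}" for j
    proof -
      \<comment> \<open>Writing \<open>j\<close> as a sum removes the truncated subtraction from the
        exponent.\<close>
      obtain d where "j = k + 2 + d"
        using j by (metis atLeastAtMost_iff le_add_diff_inverse)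
      moreover have "(k + 1, j) \<in> lk_index n"
        using j by (auto simp: lk_index_def)
      ultimately show ?thesis
        using \<open>r \<noteq> 0\<close> by (simp add: a mpar_def field_simps power_add power2_eq_square mult_2 mult_2_right)
    qed
    then have "(\<Sum>j\<in>{k+2..n}. mpar r * r ^ (j - k - 2) * in_coeff (k + 1) j) =
        (\<Sum>j\<in>{Suc (k+1)..n}. (- (c * r ^ (2 * j))) - (- (c * r ^ (2 * (j - 1)))))"
      by (intro sum.cong) auto
    also have "\<dots> = - (c * r ^ (2 * n)) - (- (c * r ^ (2 * (k + 1))))"
      using k by (intro sum_telescope'') simp
    finally show ?thesis
      by (simp add: algebra_simps)
  qed
  have 2: "(\<Sum>i\<in>{1..<k}. mpar r / (l * r ^ (k - 1 - i)) * in_coeff i (k + 1)) = c / l * (r ^ 3 - r ^ (2 * k + 1))"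
  proof -
    have "mpar r / (l * r ^ (k - 1 - i)) * in_coeff i (k + 1) = - (c / l * r ^ (2 * Suc i + 1)) - (- (c / l * r ^ (2 * i + 1)))"
      if i: "i \<in> {1..<k}" for i
    proof -
      obtain d where "k = i + 1 + d"
        using i by (metis atLeastLessThan_iff less_eq_Suc_le le_add_diff_inverse Suc_eq_plus1)
      moreover have "(i, k + 1) \<in> lk_index n"
        using i k by (auto simp: lk_index_def)
      ultimately show ?thesis
        \<comment> \<open>For \<open>l = 0\<close> both sides are zero, by the convention that
          division by zero gives zero.\<close>
        using \<open>r \<noteq> 0\<close> by (cases "l = 0") (simp_all add: a mpar_def field_simps power_add power2_eq_square mult_2 mult_2_right)
    qed
    then have "(\<Sum>i\<in>{1..<k}. mpar r / (l * r ^ (k - 1 - i)) * in_coeff i (k + 1)) =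
        (\<Sum>i\<in>{1..<k}. - (c / l * r ^ (2 * Suc i + 1)) - (- (c / l * r ^ (2 * i + 1))))"
      by (intro sum.cong) auto
    also have "\<dots> = - (c / l * r ^ (2 * k + 1)) - (- (c / l * r ^ (2 * 1 + 1)))"
      using k by (intro sum_Suc_diff') simp
    finally show ?thesis
      by (simp add: algebra_simps power3_eq_cube)
  qed
  have "(k, k + 1) \<in> lk_index n"
    using k by (auto simp: lk_index_def)
  then have "in_coeff k (k + 1) = c * r ^ (2 * k + 1)"
    using a by (simp add: mult_2)
  then show ?thesis
    unfolding nu_coeff_middle 1 2 by (simp add: divide_inverse algebra_simps)
qed

end

text \<open>Inverse letters act through \<open>inv_into\<close>; injectivity is what makes that
  operator undo \<open>nu_k\<close> on its image.\<close>

lemma inj_on_nu: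
  assumes "1 \<le> k" "k < n" "l \<noteq> 0" "r \<noteq> 0"
  shows "inj_on (nu l r k) (carrier (lk_space n l r))"
proof (rule inj_onI)
  fix u v assume uv: "u \<in> carrier (lk_space n l r)" "v \<in> carrier (lk_space n l r)" "nu l r k u = nu l r k v"
  have "Poly_Mapping.keys (u - v) \<subseteq> Poly_Mapping.keys u \<union> Poly_Mapping.keys v"
    by (auto simp: in_keys_iff lookup_minus)
  then have "Poly_Mapping.keys (u - v) \<subseteq> lk_index n"
    using uv lk_space_keys by blast
  moreover have "nu l r k (u - v) = 0"
    using uv by (simp add: nu_diff)
  ultimately show "u = v"
    using nu_eq_0[of "u - v" n k l r] assms by simp
qed


section \<open>Common eigenvectors\<close>

text \<open>The candidate common eigenvector for the eigenvalue \<open>r\<close>, scaled so that its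
  coefficient at \<open>w_12\<close> is \<open>r ^ 3\<close>.\<close>

definition lk_eigvec :: "nat \<Rightarrow> complex \<Rightarrow> (nat \<times> nat \<Rightarrow>\<^sub>0 complex)" where
  "lk_eigvec n r = (\<Sum>(i, j)\<in>lk_index n. Poly_Mapping.single (i, j) (r ^ (i + j)))"

lemma lookup_lk_eigvec:
  "Poly_Mapping.lookup (lk_eigvec n r) (i, j) = (if (i, j) \<in> lk_index n then r ^ (i + j) else 0)"
proof -
  have "Poly_Mapping.lookup (lk_eigvec n r) (i, j) =
      (\<Sum>p\<in>lk_index n. if p = (i, j) then r ^ (i + j) else 0)"
    unfolding lk_eigvec_def lookup_sum
    by (intro sum.cong) (auto simp: lookup_single when_def split: if_splits)
  then show ?thesis by simp
qed

lemma power_base_field: "r ^ k \<in> carrier (base_field l r)"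
  by (induction k) simp_all

lemma lk_eigvec_closed: "lk_eigvec n r \<in> carrier (lk_space n l r)"
  by (auto simp: lk_space_def lookup_lk_eigvec in_keys_iff power_base_field split: if_splits)

lemma lk_eigvec_nonzero:
  assumes "n \<ge> 2" "r \<noteq> 0"
  shows "lk_eigvec n r \<noteq> 0"
proof -
  have "Poly_Mapping.lookup (lk_eigvec n r) (1, 2) \<noteq> 0"
    using assms by (simp add: lookup_lk_eigvec lk_index_def)
  then show ?thesis by auto
qed

text \<open>The bound on \<open>n\<close> keeps \<open>2 * n - 3\<close> untruncated, so
  \<open>r ^ 3\<close> can be split off from \<open>r ^ (2 * n)\<close>.\<close>

lemma l_eq_iff:
  fixes l r :: complex
  assumes "n \<ge> 2" "l \<noteq> 0" "r \<noteq> 0"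
  shows "l = 1 / r ^ (2 * n - 3) \<longleftrightarrow> r ^ 3 / l - r ^ (2 * n) = 0"
proof -
  have "r ^ (2 * n) = r ^ 3 * r ^ (2 * n - 3)"
    using assms(1) by (simp flip: power_add)
  then show ?thesis
    using assms by (simp add: field_simps)
qed

text \<open>The left and right equations hold because \<open>1 - r * mpar r = r ^ 2\<close>; the
  value of \<open>l\<close> enters only at \<open>w_(k,k+1)\<close>.\<close>

lemma nu_lk_eigvec:
  assumes "1 \<le> k" "k < n" "l \<noteq> 0" "r \<noteq> 0" "l = 1 / r ^ (2 * n - 3)"
  shows "nu l r k (lk_eigvec n r) = scale r (lk_eigvec n r)"
proof -
  let ?v = "lk_eigvec n r"
  let ?b = "\<lambda>i j. Poly_Mapping.lookup (nu l r k ?v) (i, j)"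
  note keys = lk_space_keys[OF lk_eigvec_closed[of n r l]]
  note coeff = keys \<open>1 \<le> k\<close> \<open>k < n\<close>
  have middle: "?b k (k + 1) = r * Poly_Mapping.lookup ?v (k, k + 1)"
    using nu_coeff_middle_powers[OF coeff, of 1 r l] assms l_eq_iff[of n l r] by (simp add: lookup_lk_eigvec)
  have left: "?b k j = r * Poly_Mapping.lookup ?v (k, j) \<and> ?b (k + 1) j = r * Poly_Mapping.lookup ?v (k + 1, j)"
    if "k + 2 \<le> j" "j \<le> n" for j
    using nu_coeff_left[OF coeff that, of l r] that assms(1,2,4)
    by (simp add: lookup_lk_eigvec lk_index_def mpar_def field_simps power2_eq_square)
  have right: "?b i k = r * Poly_Mapping.lookup ?v (i, k) \<and> ?b i (k + 1) = r * Poly_Mapping.lookup ?v (i, k + 1)"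
    if "1 \<le> i" "i < k" for i
    using nu_coeff_right[OF coeff that, of l r] that assms(1,2,4)
    by (simp add: lookup_lk_eigvec lk_index_def mpar_def field_simps power2_eq_square)
  have "?b i j = r * Poly_Mapping.lookup ?v (i, j)" for i j
  proof (cases "(i, j) \<in> lk_index n")
    case False
    then show ?thesis
      using nu_coeff_outside[OF coeff False, of l r] by (simp add: lookup_lk_eigvec)
  next
    case ij: True
    then show ?thesis
    proof (cases rule: lk_index_cases[where k = k])
      case disjoint
      then show ?thesis
        using nu_coeff_disjoint[OF coeff ij disjoint] by simp
    qed (use left right middle in auto)
  qed
  then show ?thesis
    by (intro poly_mapping_eqI) auto
qed

text \<open>The eigenvalues may at first differ with \<open>k\<close>. Nonvanishing of all
  coefficients comes first, since cancelling one of them identifies each eigenvalue as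
  \<open>r\<close>; the recurrences are solved afterwards. The third conclusion makes the scalar in
  the second invertible.\<close>

lemma common_eigenvector:
  assumes "n \<ge> 4" "l \<noteq> 0" "r \<noteq> 0" "v \<noteq> 0" and keys: "Poly_Mapping.keys v \<subseteq> lk_index n"
    and eig: "\<And>k. 1 \<le> k \<Longrightarrow> k < n \<Longrightarrow> \<exists>c. nu l r k v = scale c v"
  shows "l = 1 / r ^ (2 * n - 3)" and "v = scale (Poly_Mapping.lookup v (1, 2) / r ^ 3) (lk_eigvec n r)"
    and "Poly_Mapping.lookup v (1, 2) \<noteq> 0"
proof -
  let ?a = "\<lambda>i j. Poly_Mapping.lookup v (i, j)"
  obtain ev where ev: "nu l r k v = scale (ev k) v" if "1 \<le> k" "k < n" for k
    using eig by metis
  have ev_nz: "ev k \<noteq> 0" if "1 \<le> k" "k < n" for k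
    using nu_eq_0[OF keys that] ev[OF that] assms(2-4) by auto
  have left: "?a (Suc i) j = ev i * ?a i j" if "1 \<le> i" "i + 2 \<le> j" "j \<le> n" for i j
    using nu_coeff_left(1)[OF keys, of i j l r] ev[of i] that by simp
  have right: "?a i (Suc j) = ev j * ?a i j" if "1 \<le> i" "i < j" "j < n" for i j
    using nu_coeff_right(1)[OF keys, of j i l r] ev[of j] that by simp
  \<comment> \<open>Equivalences are needed: some unknown coefficient is nonzero, which is carried
    to position (1,2) and from there to every other position.\<close>
  have nz1: "?a i j \<noteq> 0 \<longleftrightarrow> ?a 1 j \<noteq> 0" if "1 \<le> i" "i < j" "j \<le> n" for i j
    using that
  proof (induction i rule: dec_induct)
    case (step i)
    then show ?case using left[of i j] ev_nz[of i] by auto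
  qed simp
  have nz2: "?a 1 j \<noteq> 0 \<longleftrightarrow> ?a 1 2 \<noteq> 0" if "2 \<le> j" "j \<le> n" for j
    using that
  proof (induction j rule: dec_induct)
    case (step j)
    then show ?case using right[of 1 j] ev_nz[of j] by auto
  qed simp
  have nz: "?a i j \<noteq> 0 \<longleftrightarrow> ?a 1 2 \<noteq> 0" if "(i, j) \<in> lk_index n" for i j
    using nz1[of i j] nz2[of j] that by (auto simp: lk_index_def)
  obtain p where "p \<in> Poly_Mapping.keys v"
    using \<open>v \<noteq> 0\<close> by (metis keys_eq_empty ex_in_conv)
  then have a12: "?a 1 2 \<noteq> 0"
    using nz[of "fst p" "snd p"] keys by (auto simp: in_keys_iff)
  then show "?a 1 2 \<noteq> 0" .
  have ev_r: "ev k = r" if "1 \<le> k" "k < n" for k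
  proof -
    \<comment> \<open>A basis vector disjoint from \<open>{k, k + 1}\<close>: this is where \<open>n \<ge> 4\<close> is needed.\<close>
    obtain i j where ij: "(i, j) \<in> lk_index n" "{i, j} \<inter> {k, k + 1} = {}"
    proof -
      consider "k = 1" | "k = 2" | "k \<ge> 3" using \<open>1 \<le> k\<close> by linarith
      then show ?thesis
        using that[of 3 4] that[of 1 4] that[of 1 2] \<open>n \<ge> 4\<close> by cases (auto simp: lk_index_def)
    qed
    then show ?thesis
      using nu_coeff_disjoint[OF keys \<open>1 \<le> k\<close> \<open>k < n\<close> ij, of l r] ev[OF that] nz[OF ij(1)] a12 by simp
  qed
  \<comment> \<open>Chosen so that \<open>c * r ^ (i + j)\<close> agrees with the coefficient at
    (1,2), the start of both inductions.\<close>
  define c where "c = ?a 1 2 / r ^ 3"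
  have row: "?a 1 j = c * r ^ (1 + j)" if "2 \<le> j" "j \<le> n" for j
    using that
  proof (induction j rule: dec_induct)
    case base
    then show ?case using \<open>r \<noteq> 0\<close> by (simp add: c_def power3_eq_cube)
  next
    case (step j)
    then show ?case using right[of 1 j] ev_r[of j] by auto
  qed
  have col: "?a i j = c * r ^ (i + j)" if "1 \<le> i" "i < j" "j \<le> n" for i j
    using that
  proof (induction i rule: dec_induct)
    case base
    then show ?case using row[of j] by simp
  next
    case (step i)
    then show ?case using left[of i j] ev_r[of i] by auto
  qed
  have a: "?a i j = c * r ^ (i + j)" if "(i, j) \<in> lk_index n" for i j
    using col that by (auto simp: lk_index_def)
  have "?a i j = Poly_Mapping.lookup (scale c (lk_eigvec n r)) (i, j)" for i j
    using a[of i j] keys by (auto simp: lookup_lk_eigvec in_keys_iff)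
  then have "v = scale c (lk_eigvec n r)"
    by (intro poly_mapping_eqI) (metis surj_pair)
  then show "v = scale (?a 1 2 / r ^ 3) (lk_eigvec n r)"
    by (simp only: c_def)
  \<comment> \<open>The condition is independent of \<open>k\<close>, so evaluating at
    \<open>k = 1\<close> suffices.\<close>
  have "c * (r ^ 3 / l - r ^ (2 * n)) = 0"
    using nu_coeff_middle_powers[OF keys, of 1 c r l] a ev[of 1] ev_r[of 1] assms by simp
  then show "l = 1 / r ^ (2 * n - 3)"
    using l_eq_iff[of n l r] assms a12 by (simp add: c_def)
qed


section \<open>Stability under the BMW algebra\<close>

text \<open>An element lies in its own coset. Together with
  \<open>bmw_algebra_subset_free_alg\<close>, this turns quantification over classes and their
  representatives into quantification over the free algebra.\<close>

lemma free_alg_mem_bmw_algebra: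
  assumes "a \<in> carrier (free_alg n l r)"
  shows "\<exists>X\<in>carrier (bmw_algebra n l r). a \<in> X"
proof -
  let ?R = "free_alg n l r" and ?I = "Idl\<^bsub>free_alg n l r\<^esub> (bmw_rels n l r)"
  interpret I: ideal ?I ?R by (rule ideal_bmw_rels)
  have "?I +>\<^bsub>?R\<^esub> a \<in> carrier (bmw_algebra n l r)"
    using assms by (auto simp: bmw_algebra_def FactRing_def A_RCOSETS_def')
  moreover have "a \<in> ?I +>\<^bsub>?R\<^esub> a"
    using assms by (rule I.a_rcos_self)
  ultimately show ?thesis by blast
qed

lemma bmw_algebra_subset_free_alg:
  assumes "X \<in> carrier (bmw_algebra n l r)" "a \<in> X"
  shows "a \<in> carrier (free_alg n l r)"
proof -
  let ?R = "free_alg n l r" and ?I = "Idl\<^bsub>free_alg n l r\<^esub> (bmw_rels n l r)"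
  interpret I: ideal ?I ?R by (rule ideal_bmw_rels)
  obtain x where "x \<in> carrier ?R" "X = ?I +>\<^bsub>?R\<^esub> x"
    using assms by (auto simp: bmw_algebra_def FactRing_def A_RCOSETS_def')
  then show ?thesis
    using assms(2) I.a_r_coset_subset_G[OF I.a_subset] by blast
qed

text \<open>The cosets exhaust the free algebra. Its one-letter words give one direction; conversely
  each element is an F-combination of words, and a word acts by composing letters.\<close>

lemma lk_invariant_iff:
  "lk_invariant n l r W \<longleftrightarrow> VectorSpace.subspace (base_field l r) W (lk_space n l r) \<and>
    (\<forall>x\<in>Gen ` {1..<n} \<union> GenInv ` {1..<n}. \<forall>v\<in>W. letter_act n l r x v \<in> W)" (is "?L \<longleftrightarrow> ?S \<and> ?R")
proof (intro iffI conjI)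
  assume L: ?L
  then show ?S by (simp add: lk_invariant_def)
  show ?R
  proof (intro ballI)
    fix x v assume xv: "x \<in> Gen ` {1..<n} \<union> GenInv ` {1..<n}" "v \<in> W"
    let ?a = "Poly_Mapping.single (Word [x]) 1"
    have "?a \<in> carrier (free_alg n l r)"
      using xv by (intro free_alg_single) (auto simp: bmw_words_def)
    then have "free_act n l r ?a v \<in> W"
      using L xv(2) free_alg_mem_bmw_algebra unfolding lk_invariant_def by blast
    then show "letter_act n l r x v \<in> W"
      by (simp add: free_act_def)
  qed
next
  assume SR: "?S \<and> ?R"
  then have sub: "submodule (base_field l r) W (lk_space n l r)"
    by (simp add: subspace_def)
  have word: "foldr (letter_act n l r) xs v \<in> W"
    if "set xs \<subseteq> Gen ` {1..<n} \<union> GenInv ` {1..<n}" "v \<in> W" for xs v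
    using that SR by (induction xs) auto
  have "free_act n l r a v \<in> W" if a: "a \<in> carrier (free_alg n l r)" and v: "v \<in> W" for a v
  proof -
    have "(\<Sum>u\<in>A. scale (Poly_Mapping.lookup a u) (foldr (letter_act n l r) (letters u) v)) \<in> W"
      if "finite A" "A \<subseteq> Poly_Mapping.keys a" for A
      using that
    proof (induction A rule: finite_induct)
      case empty
      then show ?case
        using submodule.zero_closed[OF sub] by (simp add: lk_space_simps)
    next
      case (insert u A)
      have "u \<in> bmw_words n" "Poly_Mapping.lookup a u \<in> carrier (base_field l r)"
        using insert.prems a by (auto simp: free_alg_def)
      then have "scale (Poly_Mapping.lookup a u) (foldr (letter_act n l r) (letters u) v) \<in> W"
        using word[of "letters u" v] v submodule.smult_closed[OF sub]
        by (simp add: lk_space_simps bmw_words_def)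
      then show ?case
        using insert submodule.m_closed[OF sub] by (simp add: lk_space_simps)
    qed
    then show ?thesis
      by (simp add: free_act_def)
  qed
  then show ?L
    using SR unfolding lk_invariant_def by (metis bmw_algebra_subset_free_alg)
qed

section \<open>Invariant lines and their classification\<close>

lemma lk_invariant_lineD:
  assumes "lk_invariant n l r (line l r v)" "1 \<le> k" "k < n"
  shows "\<exists>c. nu l r k v = scale c v"
proof -
  have "v \<in> line l r v"
    unfolding line_def by (intro CollectI exI[of _ 1]) simp
  moreover have "Gen k \<in> Gen ` {1..<n} \<union> GenInv ` {1..<n}"
    using assms by auto
  ultimately have "letter_act n l r (Gen k) v \<in> line l r v"
    using assms(1) unfolding lk_invariant_iff by blast
  then show ?thesis
    by (auto simp: line_def)
qed

lemma lk_invariant_lineI: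
  assumes "l \<noteq> 0" "r \<noteq> 0" and v: "v \<in> carrier (lk_space n l r)"
    and eig: "\<And>k. 1 \<le> k \<Longrightarrow> k < n \<Longrightarrow> nu l r k v = scale r v"
  shows "lk_invariant n l r (line l r v)"
  unfolding lk_invariant_iff
proof (intro conjI ballI)
  show "VectorSpace.subspace (base_field l r) (line l r v) (lk_space n l r)"
    using v by (rule subspace_line)
  fix x w assume x: "x \<in> Gen ` {1..<n} \<union> GenInv ` {1..<n}" and "w \<in> line l r v"
  then obtain c where c: "c \<in> carrier (base_field l r)" "w = scale c v"
    by (auto simp: line_def)
  obtain k where k: "1 \<le> k" "k < n" "x = Gen k \<or> x = GenInv k"
    using x by auto
  from k(3) show "letter_act n l r x w \<in> line l r v"
  proof
    assume "x = Gen k"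
    then have "letter_act n l r x w = scale (c * r) v"
      using c k eig by (simp add: nu_scale)
    then show ?thesis
      using c unfolding line_def by (intro CollectI exI[of _ "c * r"]) simp
  next
    assume "x = GenInv k"
    \<comment> \<open>This is the preimage of \<open>w\<close> under \<open>nu_k\<close>; by
      injectivity, \<open>inv_into\<close> must return it.\<close>
    have "scale (c / r) v \<in> carrier (lk_space n l r)"
      using c v by (simp add: lk_space_closed)
    moreover have "nu l r k (scale (c / r) v) = w"
      using c k eig \<open>r \<noteq> 0\<close> by (simp add: nu_scale)
    ultimately have "letter_act n l r x w = scale (c / r) v"
      using \<open>x = GenInv k\<close> inv_into_f_f[OF inj_on_nu[OF k(1,2) assms(1,2)]] by fastforce
    then show ?thesis
      using c unfolding line_def by (intro CollectI exI[of _ "c / r"]) simp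
  qed
qed

text \<open>Both \<open>l\<close> and the explicit set \<open>W\<close> are pinned down at once, so
  existence and uniqueness follow from the same equivalence.\<close>

lemma invariant_line_iff:
  assumes "n \<ge> 4" "l \<noteq> 0" "r \<noteq> 0"
  shows "lk_invariant n l r W \<and> lk_dim n l r W = 1 \<longleftrightarrow>
    l = 1 / r ^ (2 * n - 3) \<and> W = line l r (lk_eigvec n r)" (is "?L \<longleftrightarrow> ?R")
proof
  assume L: ?L
  then obtain v where v: "v \<in> carrier (lk_space n l r)" "v \<noteq> 0" "W = line l r v"
    using lk_dim_eq_1_iff[of l r W n] by (auto simp: lk_invariant_iff)
  let ?c = "Poly_Mapping.lookup v (1, 2) / r ^ 3"
  note eig = common_eigenvector[OF assms v(2) lk_space_keys[OF v(1)]]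
  have "\<exists>c. nu l r k v = scale c v" if "1 \<le> k" "k < n" for k
    using L v(3) that by (blast intro: lk_invariant_lineD)
  then have "l = 1 / r ^ (2 * n - 3)" "v = scale ?c (lk_eigvec n r)" "?c \<noteq> 0"
    using eig \<open>r \<noteq> 0\<close> by auto
  \<comment> \<open>Lines are taken over F, so a complex scalar outside F could change the
    line.\<close>
  moreover have "?c \<in> carrier (base_field l r)"
    using lk_space_lookup[OF v(1)] power_base_field by simp
  ultimately show ?R
    using v(3) line_scale by metis
next
  assume R: ?R
  then have "lk_invariant n l r W"
    using assms lk_invariant_lineI[OF _ _ lk_eigvec_closed] nu_lk_eigvec by blast
  moreover have "lk_dim n l r W = 1"
    using R assms lk_dim_eq_1_iff[of l r W n] lk_eigvec_closed[of n r l] lk_eigvec_nonzero[of n r] by auto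
  ultimately show ?L ..
qed

theorem theoremA:
  fixes n :: nat and l r :: complex
  assumes "n \<ge> 4" and "l \<noteq> 0" and "r \<noteq> 0"
    and "\<forall>k\<in>{1..n}. (r\<^sup>2) ^ k \<noteq> 1"
  shows "((\<exists>W. lk_invariant n l r W \<and> lk_dim n l r W = 1) \<longleftrightarrow> l = 1 / r ^ (2 * n - 3)) \<and>
    (l = 1 / r ^ (2 * n - 3) \<longrightarrow> (\<exists>!W. lk_invariant n l r W \<and> lk_dim n l r W = 1))"
  \<comment> \<open>After rewriting, \<open>W\<close> is equated with one fixed set under the
    condition on \<open>l\<close>; only logic remains.\<close>
  unfolding invariant_line_iff[OF assms(1-3)] by (rule conjI; metis)

end
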